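(* Let $\mathbf K$ be $\mathbf R$, $\mathbf C$ or a non-Archimedean field, and let $(X,2^X_\delta,\rho)$ be a $\kappa$-normed topological vector space over $\mathbf K$. Then $X$ is locally convex.
   Context: For a topological space $X$, $2^X_o$ is the family of all canonical closed (regular closed) subsets of $X$ (closures of their interiors) and $2^X_\delta$ is the family of all closed $G_\delta$-subsets of $X$. Let $S_X$ be $2^X_o$ or $2^X_\delta$, where $X$ is a topological vector space over $\mathbf K$. A $\kappa$-norm on $(X,S_X)=X\times S_X$ is a non-negative function $\rho(x,C)$ of $x\in X$, $C\in S_X$, such that: (N1) $\rho(x,C)=0$ iff $x\in C$; (N2) if $C\subset C'$ then $\rho(x,C)\ge\rho(x,C')$; (N3) $\rho(x,C)$ is uniformly continuous in $x\in X$ for each fixed $C\in S_X$; (N4) for each increasing transfinite sequence $\{C_\alpha\}$ in $S_X$ with $C:=\mathrm{cl}(\bigcup_\alpha C_\alpha)\in S_X$, $\rho(x,C)=\inf_\alpha\rho(x,C_\alpha)$; (N5)(a) $\rho(x+y,\mathrm{cl}(C_1+C_2))\le\rho(x,C_1)+\rho(y,C_2)$ and (b) $\rho(x,C_1)\le\rho(x,C_2)+\bar\rho(C_2,C_1)$, where $\bar\rho(C_2,C_1):=\sup_{x\in C_2}\rho(x,C_1)$ (in the non-Archimedean case with the maximum instead of the sum on the right-hand sides); (N6) $\rho(\lambda x,\lambda C)=|\lambda|\rho(x,C)$ for each $0\ne\lambda\in\mathbf K$; (N7) $\rho(x+y,y+C)=\rho(x,C)$; (N8) (if $\emptyset$ is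 considered as an element of $S_X$) $\rho(x,\emptyset)=\infty$, and $\rho(x,C)<\infty$ for each $x\in X$ and $\emptyset\ne C\in S_X$. $(X,S_X,\rho)$ is a $\kappa$-normed space if $\rho$ is a fixed $\kappa$-norm on $(X,S_X)$. Over a non-Archimedean field, locally convex means $\mathbf K$-locally convex, i.e. having a base of neighbourhoods of zero consisting of $\mathbf K$-convex balanced sets. *)

theory Defs
  imports "HOL-Analysis.Analysis"
begin

locale valued_field =
  fixes absv :: "'k::field \<Rightarrow> real"
  assumes absv_nonneg: "0 \<le> absv a"
    and absv_eq_0: "absv a = 0 \<longleftrightarrow> a = 0"
    and absv_mult: "absv (a * b) = absv a * absv b"
    and absv_triangle: "absv (a + b) \<le> absv a + absv b"

locale nonarchimedean_valued_field = valued_field +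
  assumes absv_ultrametric: "absv (a + b) \<le> max (absv a) (absv b)"

text \<open>
  Hausdorffness is not part of the definition.  Continuity of addition is
  provided by the type class.
\<close>

locale top_vector_space = valued_field absv + vector_space smul
  for absv :: "'k::field \<Rightarrow> real"
    and smul :: "'k \<Rightarrow> 'v::topological_ab_group_add \<Rightarrow> 'v" +
  assumes continuous_scale:
    "continuous_map
       (prod_topology (Metric_space.mtopology UNIV (\<lambda>a b. absv (a - b))) euclidean) euclidean
       (\<lambda>(a, x). smul a x)"

definition closed_gdelta_sets :: "'v::topological_space set set" where
  "closed_gdelta_sets = {C. closed C \<and> gdelta_in euclidean C}"

text \<open>
  The operation \<open>comb\<close> is addition in the Archimedean case and the maximum in the
  non-Archimedean case; it occurs only in the two parts of (N5).

  (N3): uniform continuity refers to the canonical uniformity of the additive topological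
  group.  The inequalities are written without subtraction so that they are also meaningful
  for the value \<open>\<infinity>\<close>, which occurs (constantly) only for the empty set.

  (N4): a transfinite sequence is a family indexed by the field of a well-order \<open>r\<close>.  Taking
  the index type to be \<open>'v set\<close> loses no generality: the range of any increasing transfinite
  sequence of subsets is well-ordered by inclusion, and the axiom depends on the range only.

  (N5a): \<open>\<rho> x\<close> has a meaning only on members of \<open>S\<close>, so the closure of the
  sum is required to belong to \<open>S\<close>.
\<close>

locale kappa_normed_space = top_vector_space absv smul
  for absv :: "'k::field \<Rightarrow> real"
    and smul :: "'k \<Rightarrow> 'v::topological_ab_group_add \<Rightarrow> 'v" +
  fixes comb :: "ennreal \<Rightarrow> ennreal \<Rightarrow> ennreal"
    and S :: "'v set set"
    and \<rho> :: "'v \<Rightarrow> 'v set \<Rightarrow> ennreal"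
  assumes N1: "C \<in> S \<Longrightarrow> \<rho> x C = 0 \<longleftrightarrow> x \<in> C"
    and N2: "\<lbrakk>C \<in> S; C' \<in> S; C \<subseteq> C'\<rbrakk> \<Longrightarrow> \<rho> x C' \<le> \<rho> x C"
    and N3: "\<lbrakk>C \<in> S; \<epsilon> > (0::real)\<rbrakk> \<Longrightarrow>
      \<exists>U. open U \<and> 0 \<in> U \<and>
        (\<forall>x y. x - y \<in> U \<longrightarrow>
          \<rho> x C \<le> \<rho> y C + ennreal \<epsilon> \<and> \<rho> y C \<le> \<rho> x C + ennreal \<epsilon>)"
    and N4: "\<And>(r :: 'v set rel) D x.
      \<lbrakk>Well_order r; Field r \<noteq> {}; \<And>i. i \<in> Field r \<Longrightarrow> D i \<in> S;
       \<And>i j. (i, j) \<in> r \<Longrightarrow> D i \<subseteq> D j; closure (\<Union>i\<in>Field r. D i) \<in> S\<rbrakk> \<Longrightarrow>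
      \<rho> x (closure (\<Union>i\<in>Field r. D i)) = (INF i\<in>Field r. \<rho> x (D i))"
    and N5a: "\<lbrakk>C\<^sub>1 \<in> S; C\<^sub>2 \<in> S; closure {a + b | a b. a \<in> C\<^sub>1 \<and> b \<in> C\<^sub>2} \<in> S\<rbrakk> \<Longrightarrow>
      \<rho> (x + y) (closure {a + b | a b. a \<in> C\<^sub>1 \<and> b \<in> C\<^sub>2}) \<le> comb (\<rho> x C\<^sub>1) (\<rho> y C\<^sub>2)"
    and N5b: "\<lbrakk>C\<^sub>1 \<in> S; C\<^sub>2 \<in> S\<rbrakk> \<Longrightarrow> \<rho> x C\<^sub>1 \<le> comb (\<rho> x C\<^sub>2) (SUP z\<in>C\<^sub>2. \<rho> z C\<^sub>1)"
    and N6: "\<lbrakk>C \<in> S; a \<noteq> 0\<rbrakk> \<Longrightarrow> \<rho> (smul a x) (smul a ` C) = ennreal (absv a) * \<rho> x C"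
    and N7: "C \<in> S \<Longrightarrow> \<rho> (x + y) ((+) y ` C) = \<rho> x C"
    and N8_empty: "{} \<in> S \<Longrightarrow> \<rho> x {} = \<infinity>"
    and N8_finite: "\<lbrakk>C \<in> S; C \<noteq> {}\<rbrakk> \<Longrightarrow> \<rho> x C < \<infinity>"

text \<open>
  Convexity over \<open>\<real>\<close> or \<open>\<complex>\<close>: in both cases the coefficients are real.
\<close>

definition scale_convex :: "('k::real_normed_field \<Rightarrow> 'v::ab_group_add \<Rightarrow> 'v) \<Rightarrow> 'v set \<Rightarrow> bool"
  where "scale_convex smul A \<longleftrightarrow>
    (\<forall>x\<in>A. \<forall>y\<in>A. \<forall>t::real. 0 \<le> t \<and> t \<le> 1 \<longrightarrow>
       smul (of_real (1 - t)) x + smul (of_real t) y \<in> A)"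

text \<open>
  Over a non-Archimedean field, convexity uses three-term combinations: the version with two
  terms is strictly weaker when the residue field has two elements.
\<close>

definition K_convex ::
    "('k::field \<Rightarrow> real) \<Rightarrow> ('k \<Rightarrow> 'v::ab_group_add \<Rightarrow> 'v) \<Rightarrow> 'v set \<Rightarrow> bool"
  where "K_convex absv smul A \<longleftrightarrow>
    (\<forall>x\<in>A. \<forall>y\<in>A. \<forall>z\<in>A. \<forall>a b c.
       absv a \<le> 1 \<and> absv b \<le> 1 \<and> absv c \<le> 1 \<and> a + b + c = 1 \<longrightarrow>
       smul a x + smul b y + smul c z \<in> A)"

definition K_balanced :: "('k \<Rightarrow> real) \<Rightarrow> ('k \<Rightarrow> 'v \<Rightarrow> 'v) \<Rightarrow> 'v set \<Rightarrow> bool"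
  where "K_balanced absv smul A \<longleftrightarrow> (\<forall>a. \<forall>x\<in>A. absv a \<le> 1 \<longrightarrow> smul a x \<in> A)"

definition locally_convex ::
    "('k::real_normed_field \<Rightarrow> 'v::topological_ab_group_add \<Rightarrow> 'v) \<Rightarrow> bool"
  where "locally_convex smul \<longleftrightarrow> neighbourhood_base_at 0 (scale_convex smul) euclidean"

definition locally_K_convex ::
    "('k::field \<Rightarrow> real) \<Rightarrow> ('k \<Rightarrow> 'v::topological_ab_group_add \<Rightarrow> 'v) \<Rightarrow> bool"
  where "locally_K_convex absv smul \<longleftrightarrow>
    neighbourhood_base_at 0 (\<lambda>A. K_convex absv smul A \<and> K_balanced absv smul A) euclidean"

end

theory Submission
  imports Defs
begin

text \<open>
  The idea is to use two kinds of closed \<open>G\<^sub>\<delta>\<close> sets.  If \<open>H\<close> is one that is a subgroup, then (N5a)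
  applied to \<open>H + H = H\<close> makes \<open>\<rho> x H\<close> subadditive in \<open>x\<close> (ultrametric when \<open>comb\<close> is the maximum);
  if \<open>H\<close> is a subspace, then (N6) makes it a continuous seminorm, whose balls are convex.  A ball of
  this seminorm need not be small merely because \<open>H\<close> is.  But let \<open>C\<close> be a closed \<open>G\<^sub>\<delta>\<close> set with
  \<open>0 \<notin> C\<close> and \<open>C + H = C\<close>.  For \<open>y \<in> C\<close>, (N5a) applied to \<open>0 = y + (- y)\<close> and \<open>C + H\<close> gives
  \<open>\<rho> 0 C \<le> \<rho> y H\<close>, because \<open>\<rho> y C = 0\<close> (lemma \<open>dist_to_invariant_set\<close>).  So the ball
  \<open>{x. \<rho> x H < \<rho> 0 C}\<close> avoids \<open>C\<close>, and it lies in a given neighbourhood \<open>V\<close> as soon as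
  \<open>- C \<subseteq> V\<close>.

  Every neighbourhood \<open>V\<close> of zero admits such a pair \<open>H\<close>, \<open>C\<close>: choose neighbourhoods
  \<open>V = U\<^sub>0, U\<^sub>1, \<dots>\<close> with \<open>U\<^sub>n\<^sub>+\<^sub>1 + U\<^sub>n\<^sub>+\<^sub>1 \<subseteq> U\<^sub>n\<close>, and let \<open>H\<close> be their intersection and \<open>- C\<close> the
  union of the sums \<open>U\<^sub>1 + \<dots> + U\<^sub>k\<close>.  If some scalar \<open>\<pi>\<close> has absolute value greater than 1, the \<open>U\<^sub>n\<close> can
  be chosen so that \<open>H\<close> is a subspace, and this settles the real case, the complex case and the case
  of a nontrivially valued non-Archimedean field.

  For the trivial absolute value, continuity of scaling says nothing about small scalars, and \<open>H\<close>
  is only a subgroup.  Its ball \<open>G\<close> is an open subgroup in \<open>V\<close>, and what is needed is an open subspace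
  in \<open>G\<close>.  Put \<open>r = \<rho> 0 (- G)\<close>.  The closed \<open>G\<^sub>\<delta>\<close> subgroups \<open>M\<close> with \<open>\<rho> x M \<ge> r\<close> off \<open>M\<close> include \<open>G\<close>, are
  open, and are stable under finite intersections, under multiplication by nonzero scalars (since
  these have absolute value 1) and, by (N4), under intersections of chains
  (lemma \<open>separated_subgroup_Inter_chain\<close>).  By Zorn's lemma there is a minimal one inside \<open>G\<close>, and
  minimality makes it a subspace.
\<close>

section \<open>Neighbourhoods of zero in a topological abelian group\<close>

lemma closure_subset_add_nhd:
  fixes A V :: "'v::topological_ab_group_add set"
  assumes "open V" "0 \<in> V"
  shows "closure A \<subseteq> {a + v | a v. a \<in> A \<and> v \<in> V}"
proof
  fix x assume x: "x \<in> closure A"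
  have "open ((\<lambda>y. x - y) -` V)"
    using assms(1) by (intro open_vimage continuous_intros)
  moreover have "x \<in> (\<lambda>y. x - y) -` V"
    using assms(2) by simp
  ultimately obtain a where "a \<in> A" "x - a \<in> V"
    using x assms(2) unfolding closure_iff_nhds_not_empty by (metis disjoint_iff order_refl vimage_eq)
  moreover have "x = a + (x - a)" by simp
  ultimately show "x \<in> {a + v | a v. a \<in> A \<and> v \<in> V}" by blast
qed

lemma open_translate:
  fixes V :: "'v::topological_ab_group_add set"
  assumes "open V"
  shows "open ((+) a ` V)"
proof -
  have "(+) a ` V = (\<lambda>x. x - a) -` V"
  proof
    show "(+) a ` V \<subseteq> (\<lambda>x. x - a) -` V" by auto
    show "(\<lambda>x. x - a) -` V \<subseteq> (+) a ` V"
    proof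
      fix x assume "x \<in> (\<lambda>x. x - a) -` V"
      moreover have "x = a + (x - a)" by simp
      ultimately show "x \<in> (+) a ` V" by blast
    qed
  qed
  then show ?thesis
    using assms by (auto intro!: open_vimage continuous_intros)
qed

lemma ex_half_nhd:
  fixes V :: "'v::topological_ab_group_add set"
  assumes "open V" "0 \<in> V"
  shows "\<exists>V'. open V' \<and> 0 \<in> V' \<and> (\<forall>x\<in>V'. \<forall>y\<in>V'. x + y \<in> V)"
proof -
  let ?add = "\<lambda>p::'v \<times> 'v. fst p + snd p"
  have "open (?add -` V)"
    using assms(1) by (intro open_vimage continuous_intros)
  moreover have "(0, 0) \<in> ?add -` V" using assms(2) by simp
  ultimately obtain A B where "open A" "open B" "(0, 0) \<in> A \<times> B" "A \<times> B \<subseteq> ?add -` V"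
    by (rule open_prod_elim)
  then show ?thesis
    by (intro exI[of _ "A \<inter> B"]) auto
qed

definition is_subgroup :: "'v::ab_group_add set \<Rightarrow> bool" where
  "is_subgroup H \<longleftrightarrow> 0 \<in> H \<and> (\<forall>x\<in>H. \<forall>y\<in>H. x + y \<in> H) \<and> (\<forall>x\<in>H. - x \<in> H)"

lemma is_subgroup_add_eq:
  assumes "is_subgroup H"
  shows "{a + b | a b. a \<in> H \<and> b \<in> H} = H"
proof -
  have "x = x + 0" for x :: 'a by simp
  then show ?thesis
    using assms unfolding is_subgroup_def by blast
qed

lemma is_subgroup_compl_add_eq:
  assumes "is_subgroup H"
  shows "{a + b | a b. a \<in> - H \<and> b \<in> H} = - H"
proof -
  have "a + b \<notin> H" if "a \<notin> H" "b \<in> H" for a b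
  proof
    assume "a + b \<in> H"
    then have "(a + b) + - b \<in> H"
      using assms that unfolding is_subgroup_def by blast
    then show False using that by simp
  qed
  moreover have "x = x + 0" for x :: 'a by simp
  moreover have "0 \<in> H"
    using assms unfolding is_subgroup_def by blast
  ultimately show ?thesis by blast
qed

lemma closed_open_subgroup:
  fixes H :: "'v::topological_ab_group_add set"
  assumes "is_subgroup H" "open H"
  shows "closed H"
proof -
  have "closure H \<subseteq> {a + b | a b. a \<in> H \<and> b \<in> H}"
    using assms by (intro closure_subset_add_nhd) (auto simp: is_subgroup_def)
  then show ?thesis
    using is_subgroup_add_eq[OF assms(1)] closure_subset_eq by metis
qed

text \<open>Translating an interior point moves it to any other point of the subgroup.\<close>

lemma subgroup_open_or_empty_interior:
  fixes H :: "'v::topological_ab_group_add set"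
  assumes "is_subgroup H" "interior H \<noteq> {}"
  shows "open H"
proof -
  from assms(2) obtain x where x: "x \<in> interior H" by blast
  then have xH: "x \<in> H" using interior_subset by blast
  show ?thesis
  proof (subst open_subopen, intro ballI)
    fix y assume y: "y \<in> H"
    have "(y - x) + z \<in> H" if "z \<in> interior H" for z
    proof -
      have "(y + - x) + z \<in> H"
        using assms(1) y xH that interior_subset unfolding is_subgroup_def by blast
      then show ?thesis by simp
    qed
    moreover have "y \<in> (+) (y - x) ` interior H"
      using x by (metis diff_add_cancel image_eqI)
    ultimately show "\<exists>T. open T \<and> y \<in> T \<and> T \<subseteq> H"
      by (intro exI[of _ "(+) (y - x) ` interior H"]) (auto intro: open_translate)
  qed
qed

lemma clopen_in_closed_gdelta_sets:
  assumes "open A" "closed A"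
  shows "A \<in> closed_gdelta_sets"
  using assms by (simp add: closed_gdelta_sets_def open_imp_gdelta_in)

lemma Inter_seq_gdelta:
  fixes A :: "nat \<Rightarrow> 'v::topological_space set"
  assumes "\<And>n. open (A n)"
  shows "gdelta_in euclidean (\<Inter>n. A n)"
  using assms by (intro gdelta_in_Inter) (auto intro: open_imp_gdelta_in)

text \<open>A sequence of this kind does the work of a translation-invariant pseudometric: its intersection is
  the zero set of the pseudometric.\<close>

locale nested_nhds =
  fixes U :: "nat \<Rightarrow> 'v::topological_ab_group_add set"
  assumes op: "\<And>n. open (U n)" and zero: "\<And>n. 0 \<in> U n"
    and add: "\<And>n x y. \<lbrakk>x \<in> U (Suc n); y \<in> U (Suc n)\<rbrakk> \<Longrightarrow> x + y \<in> U n"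
    and neg: "\<And>n x. x \<in> U (Suc n) \<Longrightarrow> - x \<in> U n"
begin

lemma Inter_subgroup_gdelta:
  shows "is_subgroup (\<Inter>n. U n)" and "(\<Inter>n. U n) \<in> closed_gdelta_sets"
proof -
  let ?H = "\<Inter>n. U n"
  show "is_subgroup ?H"
    unfolding is_subgroup_def
  proof (intro conjI ballI INT_I)
    show "0 \<in> U n" for n by (rule zero)
    show "x + y \<in> U n" if "x \<in> ?H" "y \<in> ?H" for x y n
      using that by (intro add INT_D[of _ U]) auto
    show "- x \<in> U n" if "x \<in> ?H" for x n
      using that by (intro neg INT_D[of _ U]) auto
  qed
  have "closure ?H \<subseteq> U n" for n
  proof
    fix x assume "x \<in> closure ?H"
    then obtain h u where "x = h + u" "h \<in> ?H" "u \<in> U (Suc n)"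
      using closure_subset_add_nhd[OF op[of "Suc n"] zero, of ?H] by auto
    then show "x \<in> U n" using add[of h n u] by auto
  qed
  then have "closure ?H \<subseteq> ?H" by (rule INT_greatest)
  then have "closed ?H" using closure_subset_eq by blast
  then show "?H \<in> closed_gdelta_sets"
    using Inter_seq_gdelta[OF op] by (simp add: closed_gdelta_sets_def)
qed

text \<open>The set \<open>A k\<close> of the proof is \<open>U 1 + \<dots> + U k\<close>, and \<open>- C\<close> is the union of these sums.  Since
  \<open>closure (A k) \<subseteq> A (Suc k)\<close>, the union is both open and a countable union of closed sets; since
  the intersection of the \<open>U n\<close> lies in each summand, adding its elements leads from one \<open>A k\<close> only
  to the next one.\<close>

lemma ex_invariant_complement:
  obtains C where "C \<in> closed_gdelta_sets" "0 \<notin> C" "- C \<subseteq> U 0"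
    "{c + h | c h. c \<in> C \<and> h \<in> (\<Inter>n. U n)} = C"
proof -
  define A where "A = rec_nat {0} (\<lambda>k B. {b + u | b u. b \<in> B \<and> u \<in> U (Suc k)})"
  have A0: "A 0 = {0}" and
    AS: "A (Suc k) = {b + u | b u. b \<in> A k \<and> u \<in> U (Suc k)}" for k
    by (auto simp: A_def)
  (* absorbing the summands from the right: U (k+1) + U (k+1) is contained in U k *)
  have small: "a + u \<in> U 0" if "a \<in> A k" "u \<in> U k" for a u k
    using that
  proof (induction k arbitrary: a u)
    case 0
    then show ?case by (simp add: A0)
  next
    case (Suc k)
    then obtain b v where "a = b + v" "b \<in> A k" "v \<in> U (Suc k)"
      by (auto simp: AS)
    moreover from this have "b + (v + u) \<in> U 0"
      using Suc add by blast
    ultimately show ?case by (simp add: add.assoc)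
  qed
  have zeroA: "0 \<in> A k" for k
  proof (induction k)
    case (Suc k)
    then have "0 + 0 \<in> A (Suc k)" unfolding AS using zero by blast
    then show ?case by simp
  qed (simp add: A0)
  have cl: "closure (A k) \<subseteq> A (Suc k)" for k
    unfolding AS by (intro closure_subset_add_nhd op zero)
  have opA: "open (A (Suc k))" for k
  proof -
    have "A (Suc k) = (\<Union>b\<in>A k. (+) b ` U (Suc k))" by (auto simp: AS)
    then show ?thesis using op by (simp add: open_UN open_translate)
  qed
  define C where "C = (\<Inter>k. - closure (A k))"
  have C_eq: "C = - (\<Union>k. A (Suc k))"
    unfolding C_def using cl closure_subset by blast
  show thesis
  proof
    show "C \<in> closed_gdelta_sets"
      unfolding closed_gdelta_sets_def using opA C_eq Inter_seq_gdelta[of "\<lambda>k. - closure (A k)"]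
      by (auto simp: C_def closed_def)
    show "0 \<notin> C" using zeroA C_eq by blast
    have "A k \<subseteq> U 0" for k
      using small[of _ k 0] zero by auto
    then show "- C \<subseteq> U 0" using C_eq by blast
    have inv: "c + h \<in> C" if c: "c \<in> C" and h: "h \<in> (\<Inter>n. U n)" for c h
    proof (rule ccontr)
      assume "c + h \<notin> C"
      then obtain k where "c + h \<in> A (Suc k)" using C_eq by blast
      moreover have "- h \<in> U (Suc (Suc k))" using h neg by blast
      ultimately have "(c + h) + - h \<in> A (Suc (Suc k))" unfolding AS[of "Suc k"] by blast
      then show False using c C_eq by auto
    qed
    have "0 \<in> (\<Inter>n. U n)" using zero by blast
    moreover have "x = x + 0" for x :: 'v by simp
    ultimately show "{c + h | c h. c \<in> C \<and> h \<in> (\<Inter>n. U n)} = C"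
      using inv by blast
  qed
qed

end

section \<open>Continuity of scaling\<close>

context valued_field
begin

lemma absv_0 [simp]: "absv 0 = 0"
  by (simp add: absv_eq_0)

lemma absv_1 [simp]: "absv 1 = 1"
  using absv_mult[of 1 1] absv_eq_0[of 1] by simp

lemma absv_minus_1 [simp]: "absv (-1) = 1"
proof -
  have "absv (-1) * absv (-1) = 1" using absv_mult[of "-1" "-1"] by simp
  then show ?thesis using absv_nonneg[of "-1"] by (metis abs_of_nonneg abs_square_eq_1 power2_eq_square)
qed

lemma absv_minus: "absv (- a) = absv a"
  using absv_mult[of "-1" a] by simp

lemma absv_inverse: "absv (inverse a) = inverse (absv a)"
proof (cases "a = 0")
  case False
  then have "absv a * absv (inverse a) = 1" using absv_mult[of a "inverse a"] by simp
  then show ?thesis by (metis inverse_unique)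
qed simp

lemma absv_power: "absv (a ^ n) = absv a ^ n"
  by (induction n) (auto simp: absv_mult)

lemma Metric_space_absv: "Metric_space (UNIV :: 'k set) (\<lambda>a b. absv (a - b))"
proof
  fix x y z :: 'k
  show "absv (x - y) = absv (y - x)" using absv_minus[of "x - y"] by simp
  show "absv (x - z) \<le> absv (x - y) + absv (y - z)"
    using absv_triangle[of "x - y" "y - z"] by simp
qed (auto simp: absv_nonneg absv_eq_0)

end

context top_vector_space
begin

lemma continuous_on_smul: "continuous_on UNIV (smul a)"
proof -
  interpret M: Metric_space UNIV "\<lambda>a b. absv (a - b)" by (rule Metric_space_absv)
  have "continuous_map euclidean (prod_topology M.mtopology euclidean) (\<lambda>x. (a, x))"
    by (intro continuous_map_pairedI) (auto simp: continuous_map_const)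
  from continuous_map_compose[OF this continuous_scale]
  have "continuous_map euclidean euclidean (smul a)" by (simp add: comp_def)
  then show ?thesis by simp
qed

lemma nhd_scale_small:
  assumes "open V" "0 \<in> V"
  shows "\<exists>V' \<delta>. open V' \<and> 0 \<in> V' \<and> 0 < \<delta> \<and> (\<forall>a x. absv a < \<delta> \<and> x \<in> V' \<longrightarrow> smul a x \<in> V)"
proof -
  interpret M: Metric_space UNIV "\<lambda>a b. absv (a - b)" by (rule Metric_space_absv)
  let ?W = "{p. (\<lambda>(a, x). smul a x) p \<in> V}"
  have "openin (prod_topology M.mtopology euclidean) ?W"
    using openin_continuous_map_preimage[OF continuous_scale, of V] assms(1) by simp
  moreover have "(0, 0) \<in> ?W" using assms(2) by simp
  ultimately obtain A B where AB: "openin M.mtopology A" "open B" "0 \<in> A" "0 \<in> B" "A \<times> B \<subseteq> ?W"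
    unfolding openin_prod_topology_alt by (metis open_openin)
  then obtain \<delta> where d: "\<delta> > 0" "M.mball 0 \<delta> \<subseteq> A" unfolding M.openin_mtopology by blast
  have A: "a \<in> A" if "absv a < \<delta>" for a
    using d that absv_minus[of a] by (auto simp: M.mball_def)
  have "smul a x \<in> V" if "absv a < \<delta>" "x \<in> B" for a x
    using subsetD[OF AB(5), of "(a, x)"] A[OF that(1)] that(2) by simp
  then show ?thesis using AB(2,4) d(1) by blast
qed

text \<open>The last two properties are preparations for the invariance of the intersection under scalars:
  they serve for \<open>absv \<pi> > 1\<close>, when the powers of \<open>\<pi>\<close> compensate the smallness of \<open>\<delta>\<close>.\<close>

lemma ex_nested_nhds:
  assumes "open V" "0 \<in> V"
  obtains U where "nested_nhds U" "U 0 = V"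
    "\<forall>n. \<forall>x\<in>U (Suc n). smul \<pi> x \<in> U n"
    "\<forall>n. \<exists>\<delta>>0. \<forall>a x. absv a < \<delta> \<and> x \<in> U (Suc n) \<longrightarrow> smul a x \<in> U n"
proof -
  let ?P = "\<lambda>n B. open B \<and> 0 \<in> B \<and> (n = (0::nat) \<longrightarrow> B = V)"
  let ?Q = "\<lambda>(n::nat) B B'. (\<forall>x\<in>B'. \<forall>y\<in>B'. x + y \<in> B) \<and> (\<forall>x\<in>B'. - x \<in> B) \<and>
    (\<forall>x\<in>B'. smul \<pi> x \<in> B) \<and> (\<exists>\<delta>>0. \<forall>a x. absv a < \<delta> \<and> x \<in> B' \<longrightarrow> smul a x \<in> B)"
  have "\<exists>U. \<forall>n. ?P n (U n) \<and> ?Q n (U n) (U (Suc n))"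
  proof (rule dependent_nat_choice)
    show "\<exists>B. ?P 0 B" using assms by blast
  next
    fix B n assume B: "?P n B"
    obtain B1 where B1: "open B1" "0 \<in> B1" "\<forall>x\<in>B1. \<forall>y\<in>B1. x + y \<in> B"
      using ex_half_nhd[of B] B by auto
    obtain B2 \<delta> where B2: "open B2" "0 \<in> B2" "0 < \<delta>"
      "\<forall>a x. absv a < \<delta> \<and> x \<in> B2 \<longrightarrow> smul a x \<in> B"
      using nhd_scale_small[of B] B by auto
    have op: "open (uminus -` B)" "open (smul \<pi> -` B)"
      using B continuous_on_smul by (auto intro!: open_vimage continuous_intros)
    let ?B' = "B1 \<inter> B2 \<inter> uminus -` B \<inter> smul \<pi> -` B"
    have "?P (Suc n) ?B'" using B B1 B2 op by auto
    moreover have "?Q n B ?B'"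
    proof (intro conjI)
      show "\<exists>\<delta>>0. \<forall>a x. absv a < \<delta> \<and> x \<in> ?B' \<longrightarrow> smul a x \<in> B"
        using B2(3,4) by (intro exI[of _ \<delta>]) simp
    qed (use B1(3) in simp_all)
    ultimately show "\<exists>B'. ?P (Suc n) B' \<and> ?Q n B B'" by (intro exI[of _ ?B']) (rule conjI)
  qed
  then obtain U where U: "\<forall>n. ?P n (U n) \<and> ?Q n (U n) (U (Suc n))" ..
  then have P: "?P n (U n)" and Q: "?Q n (U n) (U (Suc n))" for n
    by simp_all
  show thesis
  proof
    show "U 0 = V" using P[of 0] by simp
    show "nested_nhds U" by unfold_locales (use P Q in simp_all)
  qed (use Q in simp_all)
qed

text \<open>Write \<open>a x\<close> as \<open>(a / \<pi>\<^sup>k) (\<pi>\<^sup>k x)\<close>, where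
  \<open>\<pi>\<^sup>k x\<close> still lies in the intersection and \<open>a / \<pi>\<^sup>k\<close> is small.\<close>

lemma ex_invariant_scale:
  assumes pi: "absv \<pi> > 1"
    and Upi: "\<forall>n. \<forall>x\<in>U (Suc n). smul \<pi> x \<in> U n"
    and Ud: "\<forall>n. \<exists>\<delta>>0. \<forall>a x. absv a < \<delta> \<and> x \<in> U (Suc n) \<longrightarrow> smul a x \<in> U n"
    and x: "x \<in> (\<Inter>n. U n)"
  shows "smul a x \<in> (\<Inter>n. U n)"
proof
  fix n
  obtain \<delta> where d: "\<delta> > 0" "\<And>a x. \<lbrakk>absv a < \<delta>; x \<in> U (Suc n)\<rbrakk> \<Longrightarrow> smul a x \<in> U n"
    using Ud by blast
  obtain k where k: "absv a / \<delta> < absv \<pi> ^ k"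
    using real_arch_pow[OF pi] by blast
  have pi0: "\<pi> \<noteq> 0" using pi by auto
  have "smul (\<pi> ^ j) x \<in> (\<Inter>n. U n)" for j
  proof (induction j)
    case (Suc j)
    then have "smul \<pi> (smul (\<pi> ^ j) x) \<in> (\<Inter>n. U n)" using Upi by blast
    then show ?case by (simp add: scale_scale)
  qed (use x in simp)
  then have "smul (\<pi> ^ k) x \<in> U (Suc n)" by blast
  moreover have "absv a < absv \<pi> ^ k * \<delta>"
    using k d(1) by (simp add: pos_divide_less_eq)
  then have "absv (a * inverse (\<pi> ^ k)) < \<delta>"
    using pi by (simp only: absv_mult absv_inverse absv_power)
      (simp add: field_simps)
  ultimately have "smul (a * inverse (\<pi> ^ k)) (smul (\<pi> ^ k) x) \<in> U n"
    by (rule d(2)[rotated])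
  moreover have "a * inverse (\<pi> ^ k) * \<pi> ^ k = a" using pi0 by simp
  ultimately show "smul a x \<in> U n" by (simp only: scale_scale)
qed

end

section \<open>The seminorm of a closed \<open>G\<^sub>\<delta>\<close> subgroup\<close>

text \<open>The property \<open>comb_0\<close>, shared by the sum and the maximum, lets both cases be treated at once.\<close>

locale kappa_normed_gdelta = kappa_normed_space absv smul comb closed_gdelta_sets \<rho>
  for absv :: "'k::field \<Rightarrow> real"
    and smul :: "'k \<Rightarrow> 'v::topological_ab_group_add \<Rightarrow> 'v"
    and comb :: "ennreal \<Rightarrow> ennreal \<Rightarrow> ennreal"
    and \<rho> :: "'v \<Rightarrow> 'v set \<Rightarrow> ennreal" +
  assumes comb_0: "comb 0 b = b"
begin

lemma closed_if_in_S: "C \<in> closed_gdelta_sets \<Longrightarrow> closed (C :: 'v set)"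
  by (simp add: closed_gdelta_sets_def)

lemma open_sublevel:
  assumes C: "C \<in> closed_gdelta_sets"
  shows "open {x. \<rho> x C < r}"
proof (subst open_subopen, intro ballI)
  fix x assume "x \<in> {x. \<rho> x C < r}"
  then have "\<rho> x C < r" by simp
  then obtain q where q: "\<rho> x C < q" "q < r" using dense by blast
  define e where "e = enn2real (q - \<rho> x C)"
  have "q \<noteq> \<infinity>" using q(2) by auto
  then have e: "ennreal e = q - \<rho> x C"
    by (simp add: e_def ennreal_enn2real_if)
  have "0 < q - \<rho> x C" using q(1) by (simp add: diff_gr0_ennreal)
  then have "e > 0" using e by (metis ennreal_less_zero_iff)
  then obtain V where V: "open V" "0 \<in> V" "\<And>x y. x - y \<in> V \<Longrightarrow> \<rho> x C \<le> \<rho> y C + ennreal e"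
    using N3[OF C] by metis
  let ?T = "(\<lambda>y. y - x) -` V"
  have "open ?T" using V(1) by (intro open_vimage continuous_intros)
  moreover have "x \<in> ?T" using V(2) by simp
  moreover have "?T \<subseteq> {x. \<rho> x C < r}"
  proof
    fix y assume "y \<in> ?T"
    then have "\<rho> y C \<le> \<rho> x C + (q - \<rho> x C)" using V(3)[of y x] e by auto
    also have "\<dots> = q" using q(1) by (simp add: add_diff_inverse_ennreal less_imp_le)
    finally show "y \<in> {x. \<rho> x C < r}" using q(2) by simp
  qed
  ultimately show "\<exists>T. open T \<and> x \<in> T \<and> T \<subseteq> {x. \<rho> x C < r}" by blast
qed

lemma subgroup_subadditive:
  assumes "H \<in> closed_gdelta_sets" "is_subgroup H"
  shows "\<rho> (x + y) H \<le> comb (\<rho> x H) (\<rho> y H)"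
  using N5a[OF assms(1) assms(1), of x y] assms closed_if_in_S
  by (simp add: is_subgroup_add_eq)

lemma subgroup_zero:
  assumes "H \<in> closed_gdelta_sets" "is_subgroup H"
  shows "\<rho> 0 H = 0"
  using assms N1 by (auto simp: is_subgroup_def)

lemma subgroup_minus:
  assumes "H \<in> closed_gdelta_sets" "is_subgroup H"
  shows "\<rho> (- x) H = \<rho> x H"
proof -
  have neg: "smul (-1) z = - z" for z
    by (simp add: scale_minus_left)
  have "smul (-1) ` H = H"
  proof
    show "smul (-1) ` H \<subseteq> H" using assms(2) by (auto simp: neg is_subgroup_def)
    show "H \<subseteq> smul (-1) ` H"
    proof
      fix z assume "z \<in> H"
      then have "- z \<in> H" using assms(2) by (simp add: is_subgroup_def)
      moreover have "z = smul (-1) (- z)" by (simp add: neg)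
      ultimately show "z \<in> smul (-1) ` H" by blast
    qed
  qed
  then show ?thesis
    using N6[OF assms(1), of "-1" x] by (simp add: neg)
qed

text \<open>The key estimate: \<open>0 = y + (- y)\<close>, where \<open>y\<close> has distance 0 from \<open>C\<close>, and \<open>C + H = C\<close>.  It bounds
  the distance of \<open>y\<close> from \<open>H\<close> from below.\<close>

lemma dist_to_invariant_set:
  assumes H: "H \<in> closed_gdelta_sets" "is_subgroup H"
    and C: "C \<in> closed_gdelta_sets" and inv: "{c + h | c h. c \<in> C \<and> h \<in> H} = C"
    and y: "y \<in> C"
  shows "\<rho> 0 C \<le> \<rho> y H"
proof -
  have "closure C = C" using closed_if_in_S[OF C] by simp
  then have "\<rho> (y + - y) C \<le> comb (\<rho> y C) (\<rho> (- y) H)"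
    using N5a[OF C H(1), of y "- y"] C by (simp only: inv)
  moreover have "\<rho> y C = 0" using N1[OF C] y by simp
  ultimately show ?thesis using subgroup_minus[OF H] comb_0 by simp
qed

lemma ex_small_ball:
  assumes "nested_nhds U"
  obtains r where "r > 0" "{x. \<rho> x (\<Inter>n. U n) < r} \<subseteq> U 0"
proof -
  note H = nested_nhds.Inter_subgroup_gdelta[OF assms]
  obtain C where C: "C \<in> closed_gdelta_sets" "0 \<notin> C" "- C \<subseteq> U 0"
    "{c + h | c h. c \<in> C \<and> h \<in> (\<Inter>n. U n)} = C"
    by (rule nested_nhds.ex_invariant_complement[OF assms])
  show thesis
  proof
    show "\<rho> 0 C > 0" using N1[OF C(1)] C(2) by (metis not_gr_zero)
    show "{x. \<rho> x (\<Inter>n. U n) < \<rho> 0 C} \<subseteq> U 0"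
      using dist_to_invariant_set[OF H(2,1) C(1,4)] C(3) by (force simp: not_le)
  qed
qed

lemma ex_invariant_seminorm:
  assumes pi: "absv \<pi> > 1" and V: "open V" "0 \<in> V"
  obtains p r where "r > 0" "open {x. p x < r}" "{x. p x < r} \<subseteq> V"
    "p 0 = 0" "\<forall>x y. p (x + y) \<le> comb (p x) (p y)"
    "\<forall>a x. p (smul a x) = ennreal (absv a) * p x"
proof -
  obtain U where U: "nested_nhds U" "U 0 = V"
    "\<forall>n. \<forall>x\<in>U (Suc n). smul \<pi> x \<in> U n"
    "\<forall>n. \<exists>\<delta>>0. \<forall>a x. absv a < \<delta> \<and> x \<in> U (Suc n) \<longrightarrow> smul a x \<in> U n"
    by (rule ex_nested_nhds[OF V, of \<pi>])
  let ?H = "\<Inter>n. U n"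
  note H = nested_nhds.Inter_subgroup_gdelta[OF U(1)]
  obtain r where r: "r > 0" "{x. \<rho> x ?H < r} \<subseteq> U 0"
    by (rule ex_small_ball[OF U(1)])
  have inv: "smul a x \<in> ?H" if "x \<in> ?H" for a x
    by (rule ex_invariant_scale[OF pi U(3,4) that])
  have img: "smul a ` ?H = ?H" if "a \<noteq> 0" for a
  proof
    show "smul a ` ?H \<subseteq> ?H" using inv by blast
    show "?H \<subseteq> smul a ` ?H"
    proof
      fix x assume "x \<in> ?H"
      then have "smul (inverse a) x \<in> ?H" by (rule inv)
      moreover have "x = smul a (smul (inverse a) x)" using that by (simp add: scale_scale)
      ultimately show "x \<in> smul a ` ?H" by blast
    qed
  qed
  show thesis
  proof (rule that[of r "\<lambda>x. \<rho> x ?H"])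
    have "\<rho> (smul a x) ?H = ennreal (absv a) * \<rho> x ?H" for a x
    proof (cases "a = 0")
      case True
      then show ?thesis using subgroup_zero[OF H(2,1)] by simp
    next
      case False
      then show ?thesis using N6[OF H(2), of a x] img by simp
    qed
    then show "\<forall>a x. \<rho> (smul a x) ?H = ennreal (absv a) * \<rho> x ?H" by blast
    show "\<rho> 0 ?H = 0" by (rule subgroup_zero[OF H(2,1)])
    show "open {x. \<rho> x ?H < r}" by (rule open_sublevel[OF H(2)])
    show "\<forall>x y. \<rho> (x + y) ?H \<le> comb (\<rho> x ?H) (\<rho> y ?H)"
      using subgroup_subadditive[OF H(2,1)] by blast
  qed (use r U(2) in auto)
qed

end

section \<open>Nontrivial absolute values\<close>

lemma locally_convex_if_kappa_normed:
  fixes smul :: "'k::real_normed_field \<Rightarrow> 'v::topological_ab_group_add \<Rightarrow> 'v"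
  assumes "kappa_normed_space norm smul (+) closed_gdelta_sets \<rho>"
  shows "locally_convex smul"
proof -
  interpret kappa_normed_space norm smul "(+)" closed_gdelta_sets \<rho> by (rule assms)
  interpret kappa_normed_gdelta norm smul "(+)" \<rho> by unfold_locales simp
  show ?thesis
    unfolding locally_convex_def neighbourhood_base_at_def
  proof (intro allI impI)
    fix V :: "'v set" assume "openin euclidean V \<and> 0 \<in> V"
    then have V: "open V" "0 \<in> V" by auto
    have "norm (2::'k) > 1" by simp
    then obtain p r where p: "r > 0" "open {x. p x < r}" "{x. p x < r} \<subseteq> V" "p 0 = 0"
      "\<forall>x y. p (x + y) \<le> p x + p y"
      "\<forall>a x. p (smul a x) = ennreal (norm a) * p x"
      by (rule ex_invariant_seminorm[OF _ V])
    have "scale_convex smul {x. p x < r}"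
      unfolding scale_convex_def
    proof (intro ballI allI impI)
      fix x y and t :: real
      assume x: "x \<in> {x. p x < r}" and y: "y \<in> {x. p x < r}" and t: "0 \<le> t \<and> t \<le> 1"
      define m where "m = max (p x) (p y)"
      have "p (smul (of_real (1 - t)) x + smul (of_real t) y)
          \<le> ennreal (1 - t) * p x + ennreal t * p y"
      proof -
        have "norm (of_real (1 - t) :: 'k) = 1 - t" "norm (of_real t :: 'k) = t"
          using t by (simp_all only: norm_of_real abs_of_nonneg diff_ge_0_iff_ge)
        then show ?thesis
          using p(5)[rule_format, of "smul (of_real (1 - t)) x" "smul (of_real t) y"]
          by (simp only: p(6)[rule_format])
      qed
      also have "\<dots> \<le> ennreal (1 - t) * m + ennreal t * m"
        unfolding m_def by (intro add_mono mult_left_mono) auto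
      also have "\<dots> = ennreal ((1 - t) + t) * m"
        using t by (subst ennreal_plus) (auto simp: distrib_right)
      also have "\<dots> < r" using x y by (simp add: m_def)
      finally show "smul (of_real (1 - t)) x + smul (of_real t) y \<in> {x. p x < r}" by simp
    qed
    then show "\<exists>U B. openin euclidean U \<and> scale_convex smul B \<and> 0 \<in> U \<and> U \<subseteq> B \<and> B \<subseteq> V"
      using p(1-4) by (intro exI[of _ "{x. p x < r}"]) simp
  qed
qed

lemma (in kappa_normed_gdelta) ex_K_convex_nhd:
  assumes comb: "comb = max" and pi: "absv \<pi> > 1" and V: "open V" "0 \<in> V"
  shows "\<exists>B. open B \<and> 0 \<in> B \<and> B \<subseteq> V \<and> K_convex absv smul B \<and> K_balanced absv smul B"
proof -
  obtain p r where p: "r > 0" "open {x. p x < r}" "{x. p x < r} \<subseteq> V" "p 0 = 0"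
    "\<forall>x y. p (x + y) \<le> comb (p x) (p y)"
    "\<forall>a x. p (smul a x) = ennreal (absv a) * p x"
    by (rule ex_invariant_seminorm[OF pi V])
  have sc: "p (smul a x) < r" if "absv a \<le> 1" "p x < r" for a x
  proof -
    have "ennreal (absv a) * p x \<le> 1 * p x"
      using that(1) by (intro mult_right_mono) (auto simp: ennreal_le_1)
    then show ?thesis using that(2) by (simp add: p(6))
  qed
  have ad: "p (x + y) < r" if "p x < r" "p y < r" for x y
    using p(5)[rule_format, of x y] that unfolding comb
    by (meson le_less_trans max_less_iff_conj)
  show ?thesis
    by (intro exI[of _ "{x. p x < r}"])
      (use p(1-4) in \<open>auto simp: K_convex_def K_balanced_def intro!: sc ad\<close>)
qed

section \<open>The trivial absolute value\<close>

text \<open>(N4) speaks of well-ordered families, whereas Zorn's lemma produces arbitrary chains.  To pass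
  from one to the other, well-order the chain arbitrarily and keep those members that are contained
  in all their predecessors.  On them the well-order agrees with reverse inclusion, and below every
  member \<open>M\<close> there is one of them, namely the first member contained in \<open>M\<close>.\<close>

lemma ex_well_ordered_coinitial:
  fixes \<C> :: "'v set set"
  assumes chain: "\<And>M N. \<lbrakk>M \<in> \<C>; N \<in> \<C>\<rbrakk> \<Longrightarrow> M \<subseteq> N \<or> N \<subseteq> M"
  obtains W where "Well_order W" "Field W \<subseteq> \<C>" "\<forall>M\<in>\<C>. \<exists>N\<in>Field W. N \<subseteq> M"
    "\<forall>(M, N)\<in>W. N \<subseteq> M"
proof -
  obtain R where R: "well_order_on \<C> R" using well_order_on by blast
  then have F: "Field R = \<C>" and wo: "Well_order R"
    using well_order_on_Field well_order_on_Well_order by blast+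
  have wf: "wf (R - Id)" using R by (simp add: well_order_on_def)
  define E where "E = {M \<in> \<C>. \<forall>N\<in>\<C>. (N, M) \<in> R \<longrightarrow> M \<subseteq> N}"
  have "Refl R" using wo by (simp add: well_order_on_def linear_order_on_def partial_order_on_def preorder_on_def)
  then have FE: "Field (Restr R E) = E"
    using Refl_Field_Restr[of R E] F by (auto simp: E_def)
  show thesis
  proof
    show "Well_order (Restr R E)" by (rule Well_order_Restr[OF wo])
    show "Field (Restr R E) \<subseteq> \<C>" unfolding FE by (auto simp: E_def)
    show "\<forall>(M, N)\<in>Restr R E. N \<subseteq> M" by (auto simp: E_def)
    show "\<forall>M\<in>\<C>. \<exists>N\<in>Field (Restr R E). N \<subseteq> M"
    proof
      fix M assume M: "M \<in> \<C>"
      have "M \<in> {N \<in> \<C>. N \<subseteq> M}" using M by simp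
      with wf[unfolded wf_eq_minimal] have "\<exists>N\<in>{N \<in> \<C>. N \<subseteq> M}.
          \<forall>L. (L, N) \<in> R - Id \<longrightarrow> L \<notin> {N \<in> \<C>. N \<subseteq> M}"
        by (elim allE impE)
      then obtain N where "N \<in> {N \<in> \<C>. N \<subseteq> M}"
        and least: "\<forall>L. (L, N) \<in> R - Id \<longrightarrow> L \<notin> {N \<in> \<C>. N \<subseteq> M}" ..
      then have N: "N \<in> \<C>" "N \<subseteq> M" by simp_all
      have "N \<subseteq> L" if L: "L \<in> \<C>" "(L, N) \<in> R" for L
      proof (cases "L = N")
        case False
        then have "\<not> L \<subseteq> M" using least L by blast
        then show ?thesis using chain[OF L(1) M] N(2) by blast
      qed simp
      then have "N \<in> E" using N(1) by (auto simp: E_def)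
      then show "\<exists>N\<in>Field (Restr R E). N \<subseteq> M" using FE N(2) by blast
    qed
  qed
qed

locale kappa_normed_trivial_absv = kappa_normed_gdelta absv smul max \<rho>
  for absv :: "'k::field \<Rightarrow> real"
    and smul :: "'k \<Rightarrow> 'v::topological_ab_group_add \<Rightarrow> 'v"
    and \<rho> :: "'v \<Rightarrow> 'v set \<Rightarrow> ennreal" +
  assumes trivial_absv: "a \<noteq> 0 \<Longrightarrow> absv a = 1"
begin

text \<open>It is essential that the bound \<open>r\<close> is the same for all subgroups of a family: it then survives
  in their intersection, by (N2).\<close>

definition separated_subgroup :: "ennreal \<Rightarrow> 'v set \<Rightarrow> bool" where
  "separated_subgroup r M \<longleftrightarrow>
    M \<in> closed_gdelta_sets \<and> is_subgroup M \<and> (\<forall>x. x \<notin> M \<longrightarrow> r \<le> \<rho> x M)"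

text \<open>The subgroup is the ball of radius \<open>r\<close> of its own distance function.\<close>

lemma open_separated_subgroup:
  assumes "r > 0" "separated_subgroup r M"
  shows "open M"
proof -
  have M: "M \<in> closed_gdelta_sets" "\<And>x. x \<notin> M \<Longrightarrow> r \<le> \<rho> x M"
    using assms(2) by (auto simp: separated_subgroup_def)
  have "x \<in> M \<longleftrightarrow> \<rho> x M < r" for x
    using N1[OF M(1), of x] M(2)[of x] assms(1) by (metis not_less)
  then have "M = {x. \<rho> x M < r}" by blast
  then show ?thesis using open_sublevel[OF M(1), of r] by simp
qed

lemma separated_subgroup_Int:
  assumes "separated_subgroup r M" "separated_subgroup r N"
  shows "separated_subgroup r (M \<inter> N)"
proof -
  have MN: "M \<in> closed_gdelta_sets" "N \<in> closed_gdelta_sets"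
    using assms by (auto simp: separated_subgroup_def)
  then have I: "M \<inter> N \<in> closed_gdelta_sets"
    by (auto simp: closed_gdelta_sets_def gdelta_in_Int)
  have "r \<le> \<rho> x (M \<inter> N)" if "x \<notin> M \<inter> N" for x
    using N2[OF I MN(1), of x] N2[OF I MN(2), of x] that assms
    by (auto simp: separated_subgroup_def intro: order_trans)
  then show ?thesis
    using I assms by (auto simp: separated_subgroup_def is_subgroup_def)
qed

lemma smul_image_eq_vimage: "a \<noteq> 0 \<Longrightarrow> smul a ` M = smul (inverse a) -` M"
proof
  assume a: "a \<noteq> 0"
  show "smul a ` M \<subseteq> smul (inverse a) -` M" using a by auto
  show "smul (inverse a) -` M \<subseteq> smul a ` M"
  proof
    fix x assume "x \<in> smul (inverse a) -` M"
    moreover have "x = smul a (smul (inverse a) x)" using a by simp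
    ultimately show "x \<in> smul a ` M" by blast
  qed
qed

lemma separated_subgroup_scale:
  assumes r: "r > 0" and M: "separated_subgroup r M" and a: "a \<noteq> 0"
  shows "separated_subgroup r (smul a ` M)"
proof -
  have S: "M \<in> closed_gdelta_sets" and sub: "is_subgroup M"
    and sep: "\<And>x. x \<notin> M \<Longrightarrow> r \<le> \<rho> x M"
    using M by (auto simp: separated_subgroup_def)
  have "open (smul a ` M)" "closed (smul a ` M)"
    unfolding smul_image_eq_vimage[OF a]
    using open_separated_subgroup[OF r M] closed_if_in_S[OF S] continuous_on_smul
    by (auto intro: open_vimage closed_vimage)
  moreover have "is_subgroup (smul a ` M)"
    unfolding smul_image_eq_vimage[OF a] using sub
    by (auto simp: is_subgroup_def scale_right_distrib)
  moreover have "r \<le> \<rho> x (smul a ` M)" if "x \<notin> smul a ` M" for x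
  proof -
    have "smul (inverse a) x \<notin> M" using that smul_image_eq_vimage[OF a] by blast
    moreover have "\<rho> x (smul a ` M) = \<rho> (smul (inverse a) x) M"
      using N6[OF S a, of "smul (inverse a) x"] trivial_absv[OF a] a by simp
    ultimately show ?thesis using sep by simp
  qed
  ultimately show ?thesis
    unfolding separated_subgroup_def by (simp add: clopen_in_closed_gdelta_sets)
qed

text \<open>The only question is whether the intersection is a \<open>G\<^sub>\<delta>\<close> set.  If it is open, this is clear.
  Otherwise it has empty interior, so the complements of the members of the chain fill a dense set,
  and (N4) gives members \<open>M\<close> with \<open>\<rho> 0 (- M)\<close> arbitrarily small.  A member contained in all of a
  sequence of these would satisfy \<open>\<rho> 0 (- N) = 0\<close>, that is \<open>0 \<in> - N\<close>.  So the sequence is coinitial in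
  the chain, and the intersection is that of a sequence of open sets.\<close>

lemma separated_subgroup_Inter_chain:
  assumes r: "r > 0" and ne: "\<C> \<noteq> {}"
    and chain: "\<And>M N. \<lbrakk>M \<in> \<C>; N \<in> \<C>\<rbrakk> \<Longrightarrow> M \<subseteq> N \<or> N \<subseteq> M"
    and sep: "\<And>M. M \<in> \<C> \<Longrightarrow> separated_subgroup r M"
  shows "separated_subgroup r (\<Inter>\<C>)"
proof -
  have inS: "M \<in> closed_gdelta_sets" "is_subgroup M" "open M" if "M \<in> \<C>" for M
    using sep[OF that] open_separated_subgroup[OF r] by (auto simp: separated_subgroup_def)
  have compl: "- M \<in> closed_gdelta_sets" if "M \<in> \<C>" for M
    using inS[OF that] closed_if_in_S by (intro clopen_in_closed_gdelta_sets) auto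
  have sub: "is_subgroup (\<Inter>\<C>)" using inS(2) unfolding is_subgroup_def by blast
  have cl: "closed (\<Inter>\<C>)" using inS(1) closed_if_in_S by blast
  have gd: "\<Inter>\<C> \<in> closed_gdelta_sets"
  proof (cases "open (\<Inter>\<C>)")
    case True
    then show ?thesis using cl by (rule clopen_in_closed_gdelta_sets)
  next
    case False
    obtain W where W: "Well_order W" "Field W \<subseteq> \<C>"
      "\<forall>M\<in>\<C>. \<exists>N\<in>Field W. N \<subseteq> M" "\<forall>(M, N)\<in>W. N \<subseteq> M"
      by (rule ex_well_ordered_coinitial[OF chain])
    have "Field W \<noteq> {}" using ne W(3) by blast
    have "(\<Union>M\<in>Field W. - M) = - \<Inter>\<C>" using W(2,3) by blast
    moreover have "interior (\<Inter>\<C>) = {}"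
      using subgroup_open_or_empty_interior[OF sub] False by blast
    ultimately have dense: "closure (\<Union>M\<in>Field W. - M) = UNIV"
      by (simp add: closure_complement)
    have UNIV: "(UNIV :: 'v set) \<in> closed_gdelta_sets" by (intro clopen_in_closed_gdelta_sets) auto
    have "\<rho> 0 (closure (\<Union>M\<in>Field W. - M)) = (INF M\<in>Field W. \<rho> 0 (- M))"
      using \<open>Field W \<noteq> {}\<close> W(1,2,4) compl UNIV dense by (intro N4) auto
    then have inf: "(INF M\<in>Field W. \<rho> 0 (- M)) = 0"
      using N1[OF UNIV, of 0] dense by simp
    have "\<exists>M\<in>Field W. \<rho> 0 (- M) < ennreal (inverse (real (Suc n)))" for n
    proof -
      have "(INF M\<in>Field W. \<rho> 0 (- M)) < ennreal (inverse (real (Suc n)))"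
        unfolding inf by simp
      then show ?thesis by (simp add: INF_less_iff)
    qed
    then obtain M where M: "\<And>n. M n \<in> Field W"
      "\<And>n. \<rho> 0 (- M n) < ennreal (inverse (real (Suc n)))"
      by metis
    have "\<exists>n. M n \<subseteq> N" if N: "N \<in> \<C>" for N
    proof (rule ccontr)
      assume "\<nexists>n. M n \<subseteq> N"
      then have "- M n \<subseteq> - N" for n using chain[OF N, of "M n"] M(1)[of n] W(2) by blast
      then have le: "\<rho> 0 (- N) \<le> \<rho> 0 (- M n)" for n
        using N2 compl[OF N] compl M(1) W(2) by blast
      have "(\<lambda>n. ennreal (inverse (real (Suc n)))) \<longlonglongrightarrow> ennreal 0"
        by (intro tendsto_ennrealI LIMSEQ_inverse_real_of_nat)
      moreover have "\<rho> 0 (- N) \<le> ennreal (inverse (real (Suc n)))" for n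
        using le[of n] M(2)[of n] by simp
      ultimately have "\<rho> 0 (- N) \<le> ennreal 0" by (intro LIMSEQ_le_const) auto
      then have "0 \<in> - N" using N1[OF compl[OF N], of 0] by simp
      then show False using inS(2)[OF N] by (simp add: is_subgroup_def)
    qed
    moreover have MC: "M n \<in> \<C>" for n using M(1) W(2) by blast
    ultimately have "\<Inter>\<C> = (\<Inter>n. M n)" by (intro antisym) (blast, fast)
    moreover have "gdelta_in euclidean (\<Inter>n. M n)"
      using inS(3)[OF MC] by (rule Inter_seq_gdelta)
    ultimately show ?thesis using cl by (simp add: closed_gdelta_sets_def)
  qed
  have "r \<le> \<rho> x (\<Inter>\<C>)" if x: "x \<notin> \<Inter>\<C>" for x
  proof -
    obtain M where M: "M \<in> \<C>" "x \<notin> M" using x by blast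
    then have "r \<le> \<rho> x M" using sep by (auto simp: separated_subgroup_def)
    also have "\<dots> \<le> \<rho> x (\<Inter>\<C>)" using N2[OF gd inS(1)[OF M(1)]] M(1) by blast
    finally show ?thesis .
  qed
  then show ?thesis using gd sub by (simp add: separated_subgroup_def)
qed

text \<open>The estimate \<open>dist_to_invariant_set\<close> is used twice: for the group \<open>H\<close>, to find the small open
  subgroup \<open>G\<close>, and then for \<open>G\<close> itself and its complement, to separate \<open>G\<close> from the points
  outside.\<close>

lemma ex_separated_subgroup:
  assumes V: "open V" "0 \<in> V"
  obtains r G where "r > 0" "separated_subgroup r G" "G \<subseteq> V"
proof -
  obtain U where U: "nested_nhds U" "U 0 = V"
    (* the scalar 1 makes the condition on multiples by \<pi> harmless *)
    by (rule ex_nested_nhds[OF V, of 1])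
  let ?H = "\<Inter>n. U n"
  note H = nested_nhds.Inter_subgroup_gdelta[OF U(1)]
  obtain s where s: "s > 0" "{x. \<rho> x ?H < s} \<subseteq> U 0"
    by (rule ex_small_ball[OF U(1)])
  define G where "G = {x. \<rho> x ?H < s}"
  have "x + y \<in> G" if "x \<in> G" "y \<in> G" for x y
    using subgroup_subadditive[OF H(2,1), of x y] that unfolding G_def
    by (metis le_less_trans max_less_iff_conj mem_Collect_eq)
  then have sub: "is_subgroup G"
    unfolding is_subgroup_def using subgroup_zero[OF H(2,1)] subgroup_minus[OF H(2,1)] s(1)
    by (simp add: G_def)
  have op: "open G" unfolding G_def by (rule open_sublevel[OF H(2)])
  then have S: "G \<in> closed_gdelta_sets" "- G \<in> closed_gdelta_sets"
    using closed_open_subgroup[OF sub] by (auto intro: clopen_in_closed_gdelta_sets)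
  show thesis
  proof
    have "0 \<notin> - G" using sub by (simp add: is_subgroup_def)
    then show "\<rho> 0 (- G) > 0" using N1[OF S(2)] by (metis not_gr_zero)
    show "separated_subgroup (\<rho> 0 (- G)) G"
      unfolding separated_subgroup_def
      using S(1) sub dist_to_invariant_set[OF S(1) sub S(2) is_subgroup_compl_add_eq[OF sub]]
      by blast
    show "G \<subseteq> V" using s(2) U(2) by (simp add: G_def)
  qed
qed

lemma ex_open_subspace:
  assumes V: "open V" "0 \<in> V"
  obtains M where "open M" "is_subgroup M" "\<forall>a. \<forall>x\<in>M. smul a x \<in> M" "M \<subseteq> V"
proof -
  obtain r G where G: "r > 0" "separated_subgroup r G" "G \<subseteq> V"
    by (rule ex_separated_subgroup[OF V])
  (* Zorn's lemma is applied to complements, because it yields maximal sets *)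
  define \<A> where "\<A> = {C. separated_subgroup r (- C) \<and> - C \<subseteq> G}"
  have "\<exists>C\<in>\<A>. \<forall>X\<in>\<A>. C \<subseteq> X \<longrightarrow> X = C"
  proof (rule subset_Zorn_nonempty)
    have "- G \<in> \<A>" using G(2) by (simp add: \<A>_def)
    then show "\<A> \<noteq> {}" by blast
  next
    fix \<C> assume ne: "\<C> \<noteq> {}" and ch: "subset.chain \<A> \<C>"
    then have "\<C> \<subseteq> \<A>" and cmp: "\<And>X Y. \<lbrakk>X \<in> \<C>; Y \<in> \<C>\<rbrakk> \<Longrightarrow> X \<subseteq> Y \<or> Y \<subseteq> X"
      by (auto simp: subset_chain_def)
    have "separated_subgroup r (- \<Union>\<C>)"
      unfolding uminus_Sup
    proof (rule separated_subgroup_Inter_chain[OF G(1)])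
      show "uminus ` \<C> \<noteq> {}" using ne by simp
      show "separated_subgroup r M" if "M \<in> uminus ` \<C>" for M
        using that \<open>\<C> \<subseteq> \<A>\<close> by (auto simp: \<A>_def)
      fix M N assume "M \<in> uminus ` \<C>" "N \<in> uminus ` \<C>"
      then obtain X Y where "M = - X" "X \<in> \<C>" "N = - Y" "Y \<in> \<C>" by blast
      then show "M \<subseteq> N \<or> N \<subseteq> M" using cmp[of X Y] by (simp add: disj_commute)
    qed
    moreover obtain X where "X \<in> \<C>" "- X \<subseteq> G"
    proof -
      obtain X where "X \<in> \<C>" using ne by auto
      moreover from this have "- X \<subseteq> G" using \<open>\<C> \<subseteq> \<A>\<close> by (auto simp: \<A>_def)
      ultimately show thesis by (rule that)
    qed
    then have "- \<Union>\<C> \<subseteq> G"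
      by (meson Compl_anti_mono Union_upper subset_trans)
    ultimately show "\<Union>\<C> \<in> \<A>"
      unfolding \<A>_def mem_Collect_eq by (rule conjI)
  qed
  then obtain C where C: "C \<in> \<A>" "\<forall>X\<in>\<A>. C \<subseteq> X \<longrightarrow> X = C" ..
  define M where "M = - C"
  have M: "separated_subgroup r M" "M \<subseteq> G" using C(1) by (auto simp: M_def \<A>_def)
  have minimal: "M \<subseteq> N" if "separated_subgroup r N" for N
  proof -
    have "- (M \<inter> N) \<in> \<A>"
      using separated_subgroup_Int[OF M(1) that] M(2) by (simp add: \<A>_def le_infI1)
    moreover have "C \<subseteq> - (M \<inter> N)" unfolding M_def by blast
    ultimately have "- (M \<inter> N) = C" using C(2) by blast
    then show ?thesis unfolding M_def by blast
  qed
  show thesis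
  proof
    show "open M" by (rule open_separated_subgroup[OF G(1) M(1)])
    show sub: "is_subgroup M" using M(1) by (simp add: separated_subgroup_def)
    show "M \<subseteq> V" using M(2) G(3) by blast
    have "smul a x \<in> M" if "x \<in> M" for a x
    proof (cases "a = 0")
      case True
      then show ?thesis using sub by (simp add: is_subgroup_def)
    next
      case False
      then have "M \<subseteq> smul (inverse a) ` M"
        using separated_subgroup_scale[OF G(1) M(1)] by (intro minimal) simp
      then have "x \<in> smul (inverse a) ` M" using that by blast
      then show ?thesis using False smul_image_eq_vimage[of "inverse a" M] by simp
    qed
    then show "\<forall>a. \<forall>x\<in>M. smul a x \<in> M" by blast
  qed
qed

end

section \<open>Local convexity\<close>

lemma locally_K_convex_if_kappa_normed:
  assumes "kappa_normed_space absv smul max closed_gdelta_sets \<rho>"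
  shows "locally_K_convex absv smul"
proof -
  interpret kappa_normed_space absv smul max closed_gdelta_sets \<rho> by (rule assms)
  interpret kappa_normed_gdelta absv smul max \<rho> by unfold_locales simp
  have nhd: "\<exists>B. open B \<and> 0 \<in> B \<and> B \<subseteq> V \<and> K_convex absv smul B \<and> K_balanced absv smul B"
    if V: "open V" "0 \<in> V" for V
  proof (cases "\<exists>\<pi>. absv \<pi> > 1")
    case True
    then show ?thesis using ex_K_convex_nhd[OF refl _ V] by blast
  next
    case False
    have "absv a = 1" if "a \<noteq> 0" for a
    proof -
      have "absv a > 0" using that absv_nonneg[of a] absv_eq_0[of a] by simp
      moreover have "absv a \<le> 1" "inverse (absv a) \<le> 1"
        using False by (metis absv_inverse not_less)+
      ultimately show ?thesis by (simp add: field_simps)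
    qed
    then interpret kappa_normed_trivial_absv absv smul \<rho> by unfold_locales
    obtain M where "open M" "is_subgroup M" "\<forall>a. \<forall>x\<in>M. smul a x \<in> M" "M \<subseteq> V"
      by (rule ex_open_subspace[OF V])
    then show ?thesis
      by (intro exI[of _ M]) (auto simp: K_convex_def K_balanced_def is_subgroup_def)
  qed
  show ?thesis
    unfolding locally_K_convex_def neighbourhood_base_at_def
  proof (intro allI impI)
    fix V :: "'b set" assume "openin euclidean V \<and> 0 \<in> V"
    then obtain B where "open B" "0 \<in> B" "B \<subseteq> V" "K_convex absv smul B" "K_balanced absv smul B"
      using nhd[of V] by auto
    then show "\<exists>U B. openin euclidean U \<and> (K_convex absv smul B \<and> K_balanced absv smul B) \<and>
        0 \<in> U \<and> U \<subseteq> B \<and> B \<subseteq> V"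
      by (intro exI[of _ B]) simp
  qed
qed

theorem theorem3p6:
  fixes smulR :: "real \<Rightarrow> 'a::topological_ab_group_add \<Rightarrow> 'a"
    and \<rho>R :: "'a \<Rightarrow> 'a set \<Rightarrow> ennreal"
    and smulC :: "complex \<Rightarrow> 'b::topological_ab_group_add \<Rightarrow> 'b"
    and \<rho>C :: "'b \<Rightarrow> 'b set \<Rightarrow> ennreal"
    and absv :: "'k::field \<Rightarrow> real"
    and smulK :: "'k \<Rightarrow> 'c::topological_ab_group_add \<Rightarrow> 'c"
    and \<rho>K :: "'c \<Rightarrow> 'c set \<Rightarrow> ennreal"
  shows "(kappa_normed_space norm smulR (+) closed_gdelta_sets \<rho>R \<longrightarrow> locally_convex smulR)
    \<and> (kappa_normed_space norm smulC (+) closed_gdelta_sets \<rho>C \<longrightarrow> locally_convex smulC)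
    \<and> (nonarchimedean_valued_field absv \<and>
        kappa_normed_space absv smulK max closed_gdelta_sets \<rho>K \<longrightarrow>
        locally_K_convex absv smulK)"
  by (intro conjI impI)
    (erule locally_convex_if_kappa_normed locally_K_convex_if_kappa_normed | erule conjE)+

end
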